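(* Let $m\ge n\ge 2$ be integers, let $0<c_1<\cdots<c_{2n-1}$ be real numbers, and set $r(t)=\prod_{i=1}^{2n-1}(1-t/c_i)$ and $f(t)=\sqrt{r(t)}$ (the branch with $f(0)=1$, near $t=0$). The generalized Cayley condition $\mathcal{C}(m,n)$ is equivalent to each of the following two conditions: (i) There exists a non-zero polynomial $s(t)\in\mathbb{R}_{m-n}[t]$ such that $$\left.\frac{\mathrm{d}^l}{\mathrm{d}t^l}\right|_{t=0}\{s(t)f(t)\}=0,\qquad l=m+1,\ldots,2m-1.$$ (ii) There exist a real number $\alpha\neq 0$ and polynomials $s(t)\in\mathbb{R}_{m-n}[t]$ and $q(t)\in\mathbb{R}_{m-1}[t]$ such that $s(0)=q(0)=1$ and $$s^2(t)\,r(t)=(\alpha t^m+q(t))\,q(t).$$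
   Context: $\mathbb{R}_k[t]$ denotes the space of real polynomials of degree at most $k$. Write $f(t)=\sum_{l\ge 0}f_l t^l$ for the Taylor expansion at $0$ of $f(t)=\sqrt{\prod_{i=1}^{2n-1}(1-t/c_i)}$, $f(0)=1$. The generalized Cayley condition $\mathcal{C}(m,n)$ (for given $c_1,\ldots,c_{2n-1}$) is: $m\ge n$ and $$\operatorname{rank}\begin{pmatrix} f_{m+1}&\cdots&f_{n+1}\\ \vdots&&\vdots\\ f_{2m-1}&\cdots&f_{m+n-1}\end{pmatrix}<m-n+1,$$ where the matrix has $m-1$ rows and $m-n+1$ columns and its $(i,j)$ entry is $f_{m+1+i-j}$. (In the billiard setting, $\{c_1,\ldots,c_{2n-1}\}=\{a_1,\ldots,a_n\}\cup\{\lambda_1,\ldots,\lambda_{n-1}\}$, where the $a_j$ are the parameters of an ellipsoid $\sum x_j^2/a_j=1$ and the $\lambda_k$ are the parameters of the caustics.) *)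

theory Defs
  imports "HOL-Analysis.Derivative" "HOL-Computational_Algebra.Polynomial"
    "Jordan_Normal_Form.DL_Rank"
begin

definition cayley_poly :: "nat \<Rightarrow> (nat \<Rightarrow> real) \<Rightarrow> real poly" where
  "cayley_poly n c = (\<Prod>i\<in>{1..2 * n - 1}. [:1, - 1 / c i:])"

text \<open>
  For nonzero \<open>c i\<close>, the polynomial \<open>cayley_poly n c\<close> is positive near 0, so there the real
  square root is the smooth branch with value 1 at 0. Below, only derivatives at 0 are used.
\<close>

definition cayley_sqrt :: "nat \<Rightarrow> (nat \<Rightarrow> real) \<Rightarrow> real \<Rightarrow> real" where
  "cayley_sqrt n c t = sqrt (poly (cayley_poly n c) t)"

definition taylor_coeff :: "(real \<Rightarrow> real) \<Rightarrow> nat \<Rightarrow> real" where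
  "taylor_coeff f l = (deriv ^^ l) f 0 / fact l"

text \<open>
  Matrix indices start at 0 here; the index difference \<open>i - j\<close> is the same as for indices
  starting at 1. The subtraction does not truncate, because \<open>j \<le> m - n\<close>.
\<close>

definition cayley_matrix :: "nat \<Rightarrow> nat \<Rightarrow> (nat \<Rightarrow> real) \<Rightarrow> real Matrix.mat" where
  "cayley_matrix m n c = Matrix.mat (m - 1) (m - n + 1)
     (\<lambda>(i, j). taylor_coeff (cayley_sqrt n c) (m + 1 + i - j))"

text \<open>The first argument of \<open>vec_space.rank\<close> is the number of rows.\<close>

definition cayley_condition :: "nat \<Rightarrow> nat \<Rightarrow> (nat \<Rightarrow> real) \<Rightarrow> bool" where
  "cayley_condition m n c \<longleftrightarrow>
     n \<le> m \<and> vec_space.rank (m - 1) (cayley_matrix m n c) < m - n + 1"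

end

theory Submission
  imports Defs "HOL-Analysis.FPS_Convergence" "HOL-Analysis.Generalised_Binomial_Theorem"
begin

text \<open>
  A kernel vector of the Cayley matrix is the coefficient vector of a polynomial \<open>s\<close> for which
  \<open>s f\<close> has no terms of degree \<open>m + 1, \<dots>, 2 m - 1\<close>. Equivalently \<open>s f = p + O(t\<^sup>2\<^sup>m)\<close> with
  \<open>p\<close> of degree at most \<open>m\<close>. Then \<open>s\<^sup>2 r - p\<^sup>2 = (s f - p) (s f + p)\<close> is \<open>O(t\<^sup>2\<^sup>m)\<close> and has degree
  at most \<open>2 m\<close>, so it is \<open>- a\<^sup>2 t\<^sup>2\<^sup>m\<close> with \<open>a\<close> the coefficient of \<open>t\<^sup>m\<close> in \<open>p\<close>; hence
  \<open>s\<^sup>2 r = (p + a t\<^sup>m) (p - a t\<^sup>m)\<close>, where \<open>q = p - a t\<^sup>m\<close> and \<open>\<alpha> = 2 a\<close>. If \<open>a\<close> or \<open>s(0)\<close>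
  vanished, this would force \<open>s\<^sup>2 r = p\<^sup>2\<close>, which is impossible because \<open>r\<close> has odd degree.
  Conversely, the factor \<open>s f + p\<close> is a unit, so that \<open>s f - p = O(t\<^sup>2\<^sup>m)\<close> can be recovered.
\<close>

section \<open>Rank and kernel\<close>

text \<open>The rank is the size of a maximal independent subset of the set of columns, and a
  repeated column makes this set smaller than \<open>nc\<close>.\<close>

lemma (in vec_space) non_distinct_cols_rank_less:
  assumes A: "A \<in> carrier_mat n nc" and nd: "\<not> distinct (cols A)"
  shows "rank A < nc"
proof -
  let ?P = "\<lambda>T. T \<subseteq> set (cols A) \<and> lin_indpt T"
  obtain S where S: "maximal S ?P"
    using maximal_exists[of ?P "card (set (cols A))" "{}"]
    by (meson List.finite_set card_mono empty_iff empty_subsetI finite_lin_indpt2 rev_finite_subset)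
  then have "card S \<le> card (set (cols A))"
    by (simp add: card_mono maximal_def)
  also have "\<dots> < length (cols A)"
    using nd card_length[of "cols A"] card_distinct[of "cols A"] by linarith
  also have "\<dots> = nc"
    using A by simp
  finally show ?thesis
    using rank_card_indpt[OF A S] by simp
qed

text \<open>For distinct columns this is linear dependence of the set of columns. That set forgets
  repetitions, so repeated columns are treated separately; then both sides hold.\<close>

lemma (in vec_space) rank_less_iff_kernel:
  assumes A: "A \<in> carrier_mat n nc"
  shows "rank A < nc \<longleftrightarrow> (\<exists>v \<in> carrier_vec nc. v \<noteq> 0\<^sub>v nc \<and> A *\<^sub>v v = 0\<^sub>v n)"
proof (cases "distinct (cols A)")
  case True
  show ?thesis
  proof
    assume "rank A < nc"
    then have "lin_dep (set (cols A))"
      using lin_indpt_full_rank[OF A True] by auto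
    then show "\<exists>v \<in> carrier_vec nc. v \<noteq> 0\<^sub>v nc \<and> A *\<^sub>v v = 0\<^sub>v n"
      using lin_depE[OF A _ True] by metis
  next
    assume "\<exists>v \<in> carrier_vec nc. v \<noteq> 0\<^sub>v nc \<and> A *\<^sub>v v = 0\<^sub>v n"
    then have "lin_dep (set (cols A))"
      using lin_depI[OF A _ _ _ True] by auto
    then have "rank A \<noteq> nc"
      using full_rank_lin_indpt[OF A _ True] by auto
    then show "rank A < nc"
      using rank_le_nc[OF A] by simp
  qed
next
  case False
  then obtain i j where ij: "i < nc" "j < nc" "i \<noteq> j" "col A i = col A j"
    using A by (auto simp: distinct_conv_nth)
  \<comment> \<open>Two equal columns cancel, so the difference of their unit vectors lies in the
    kernel.\<close>
  define v :: "'a vec" where "v = unit_vec nc i - unit_vec nc j"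
  have unit: "A *\<^sub>v unit_vec nc k = col A k" if "k < nc" for k
    using A that by (intro eq_vecI) auto
  have "A *\<^sub>v v = A *\<^sub>v unit_vec nc i - A *\<^sub>v unit_vec nc j"
    unfolding v_def using A by (intro mult_minus_distrib_mat_vec) auto
  also have "\<dots> = col A i - col A j"
    using unit ij by simp
  also have "\<dots> = 0\<^sub>v n"
    using A ij by auto
  finally have "A *\<^sub>v v = 0\<^sub>v n" .
  moreover have "v $ i = 1"
    using ij by (simp add: v_def)
  then have "v \<noteq> 0\<^sub>v nc"
    using ij by auto
  moreover have "v \<in> carrier_vec nc"
    by (simp add: v_def)
  ultimately show ?thesis
    using non_distinct_cols_rank_less[OF A False] by blast
qed

section \<open>Power series expansions of real functions\<close>

lemma has_fps_expansion_higher_deriv: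
  fixes F :: "'a :: {banach, real_normed_field} fps"
  assumes "f has_fps_expansion F"
  shows "(deriv ^^ n) f has_fps_expansion (fps_deriv ^^ n) F"
  using assms by (induction n) (auto intro: has_fps_expansion_deriv)

lemma fps_nth_0_higher_deriv:
  fixes F :: "'a :: field_char_0 fps"
  shows "fps_nth ((fps_deriv ^^ n) F) 0 = fact n * fps_nth F n"
proof (induction n arbitrary: F)
  case (Suc n)
  have "fps_nth ((fps_deriv ^^ Suc n) F) 0 = fps_nth ((fps_deriv ^^ n) (fps_deriv F)) 0"
    by (simp add: funpow_swap1)
  then show ?case
    using Suc by (simp add: algebra_simps)
qed auto

lemma has_fps_expansion_nth_0:
  assumes "f has_fps_expansion F"
  shows "f 0 = fps_nth F 0"
  using assms by (auto simp: has_fps_expansion_def eval_fps_at_0 dest: eventually_nhds_x_imp_x)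

lemma has_fps_expansion_deriv_at_0:
  fixes F :: "'a :: {banach, real_normed_field} fps"
  assumes "f has_fps_expansion F"
  shows "(deriv ^^ n) f 0 = fact n * fps_nth F n"
  using has_fps_expansion_nth_0[OF has_fps_expansion_higher_deriv[OF assms]]
  by (simp add: fps_nth_0_higher_deriv)

text \<open>The coefficients are derivatives at 0 divided by factorials, so they depend only on the
  function near 0. This turns local identities of functions into identities of series.\<close>

lemma has_fps_expansion_unique:
  fixes F :: "'a :: {banach, real_normed_field} fps"
  assumes "f has_fps_expansion F" and "g has_fps_expansion G"
    and "eventually (\<lambda>x. f x = g x) (nhds 0)"
  shows "F = G"
proof -
  have "f has_fps_expansion G"
    using assms(2,3) unfolding has_fps_expansion_def
    by (auto elim: eventually_elim2)
  then show ?thesis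
    using has_fps_expansion_deriv_at_0[OF assms(1)] has_fps_expansion_deriv_at_0[of f G]
    by (auto simp: fps_eq_iff)
qed

lemma has_fps_expansion_poly:
  fixes p :: "'a :: {banach, real_normed_field} poly"
  shows "poly p has_fps_expansion fps_of_poly p"
  by (simp add: has_fps_expansion_def)

lemma has_fps_expansion_sqrt_linear:
  fixes a :: real
  shows "(\<lambda>t. sqrt (1 + a * t)) has_fps_expansion Abs_fps (\<lambda>k. ((1/2) gchoose k) * a ^ k)"
proof (rule has_fps_expansionI)
  have "eventually (\<lambda>t. \<bar>a * t\<bar> < 1) (nhds 0)"
    using eventually_nhds_in_open[of "{t. \<bar>a * t\<bar> < 1}" 0]
    by (simp add: open_Collect_less continuous_intros)
  then show "eventually (\<lambda>t. (\<lambda>k. fps_nth (Abs_fps (\<lambda>k. ((1/2) gchoose k) * a ^ k)) k * t ^ k)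
      sums sqrt (1 + a * t)) (nhds 0)"
  proof eventually_elim
    case (elim t)
    then show ?case
      using sqrt_series[of "a * t"] by (simp add: power_mult_distrib mult.assoc)
  qed
qed

lemma sqrt_prod: "sqrt (prod f A) = (\<Prod>i\<in>A. sqrt (f i))"
  by (induction A rule: infinite_finite_induct) (auto simp: real_sqrt_mult)

text \<open>The series is the product of the binomial series of the linear factors.\<close>

lemma cayley_sqrt_expansion:
  obtains F :: "real fps" where "cayley_sqrt n c has_fps_expansion F"
    and "F ^ 2 = fps_of_poly (cayley_poly n c)" and "fps_nth F 0 = 1"
proof -
  define F where "F = (\<Prod>i\<in>{1..2 * n - 1}. Abs_fps (\<lambda>k. ((1/2) gchoose k) * (- 1 / c i) ^ k))"
  \<comment> \<open>This holds for all \<open>t\<close>: \<open>sqrt\<close> is odd on the reals,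
    hence multiplicative for negative arguments too.\<close>
  have "cayley_sqrt n c = (\<lambda>t. \<Prod>i\<in>{1..2 * n - 1}. sqrt (1 + (- 1 / c i) * t))"
    by (simp add: cayley_sqrt_def cayley_poly_def poly_prod sqrt_prod fun_eq_iff mult.commute)
  then have F: "cayley_sqrt n c has_fps_expansion F"
    unfolding F_def using has_fps_expansion_sqrt_linear by (simp only: has_fps_expansion_prod)
  have r0: "poly (cayley_poly n c) 0 = 1"
    by (simp add: cayley_poly_def poly_prod)
  have "eventually (\<lambda>t. 0 < poly (cayley_poly n c) t) (nhds 0)"
    using eventually_nhds_in_open[of "{t. 0 < poly (cayley_poly n c) t}" 0]
    by (simp add: r0 open_Collect_less continuous_intros)
  \<comment> \<open>Squaring undoes \<open>sqrt\<close> only where the polynomial is nonnegative,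
    hence the restriction to a neighbourhood of 0.\<close>
  then have "eventually (\<lambda>t. cayley_sqrt n c t * cayley_sqrt n c t = poly (cayley_poly n c) t) (nhds 0)"
    by eventually_elim (simp add: cayley_sqrt_def)
  with has_fps_expansion_mult[OF F F] has_fps_expansion_poly
  have "F * F = fps_of_poly (cayley_poly n c)"
    by (rule has_fps_expansion_unique)
  moreover have "fps_nth F 0 = 1"
    using has_fps_expansion_nth_0[OF F] by (simp add: cayley_sqrt_def r0)
  ultimately show ?thesis
    using that F by (simp add: power2_eq_square)
qed

lemma degree_cayley_poly:
  assumes "\<And>i. i \<in> {1..2 * n - 1} \<Longrightarrow> c i \<noteq> 0"
  shows "degree (cayley_poly n c) = 2 * n - 1"
proof -
  have "degree (cayley_poly n c) = (\<Sum>i\<in>{1..2 * n - 1}. degree [:1, - 1 / c i:])"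
    unfolding cayley_poly_def by (rule degree_prod_eq_sum_degree) auto
  \<comment> \<open>Since \<open>1 / 0 = 0\<close>, a factor with \<open>c i = 0\<close> would be
    constant.\<close>
  also have "\<dots> = (\<Sum>i\<in>{1..2 * n - 1}. 1)"
    using assms by (intro sum.cong) auto
  finally show ?thesis
    by simp
qed

section \<open>Polynomial approximations to a square root\<close>

text \<open>Order of vanishing at 0 becomes divisibility, so that products can be estimated and
  units cancelled.\<close>

lemma fps_X_power_dvd_iff:
  fixes A :: "'a :: field fps"
  shows "fps_X ^ N dvd A \<longleftrightarrow> (\<forall>k<N. fps_nth A k = 0)"
proof
  assume "\<forall>k<N. fps_nth A k = 0"
  then have "A = fps_X ^ N * fps_shift N A"
    by (auto simp: fps_eq_iff fps_X_power_mult_nth)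
  then show "fps_X ^ N dvd A"
    by (rule dvdI)
qed (auto simp: dvd_def fps_X_power_mult_nth)

text \<open>The left side has odd degree, whereas a square has even degree.\<close>

lemma odd_degree_square_mult_neq_square:
  fixes p r s :: "'a :: idom poly"
  assumes "odd (degree r)" and "s \<noteq> 0"
  shows "s ^ 2 * r \<noteq> p ^ 2"
proof
  assume eq: "s ^ 2 * r = p ^ 2"
  have "r \<noteq> 0"
    using assms by auto
  then have "degree (s ^ 2 * r) = 2 * degree s + degree r"
    using assms by (simp add: degree_mult_eq degree_power_eq)
  moreover have "degree (p ^ 2) = 2 * degree p"
    by (cases "p = 0") (simp_all add: degree_power_eq)
  ultimately show False
    using assms eq by (metis dvd_triv_left even_add)
qed

lemma fps_square_diff:
  fixes F :: "'a :: comm_ring_1 fps"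
  assumes "F ^ 2 = fps_of_poly r"
  shows "fps_of_poly (s ^ 2 * r - p ^ 2) =
    (fps_of_poly s * F - fps_of_poly p) * (fps_of_poly s * F + fps_of_poly p)"
  by (simp add: fps_of_poly_diff fps_of_poly_mult power2_eq_square algebra_simps
      flip: assms)

lemma pell_of_vanishing_coeffs:
  fixes F :: "'a :: field_char_0 fps"
  assumes F: "F ^ 2 = fps_of_poly r" "fps_nth F 0 = 1"
    and r: "degree r = 2 * n - 1" and n: "0 < n" "n \<le> m"
    and s: "s \<noteq> 0" "degree s \<le> m - n"
    and van: "\<forall>l\<in>{m + 1..2 * m - 1}. fps_nth (fps_of_poly s * F) l = 0"
  defines "p \<equiv> truncate_fps (m + 1) (fps_of_poly s * F)"
  shows "s ^ 2 * r = p ^ 2 - monom ((coeff p m)\<^sup>2) (2 * m)"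
    and "coeff p m \<noteq> 0" and "coeff s 0 \<noteq> 0" and "degree p \<le> m" and "coeff p 0 = coeff s 0"
proof -
  define D where "D = s ^ 2 * r - p ^ 2"
  note fac = fps_square_diff[OF F(1), of s p, folded D_def]
  have coeff_p: "coeff p k = (if k \<le> m then fps_nth (fps_of_poly s * F) k else 0)" for k
    by (auto simp: p_def coeff_truncate_fps)
  show deg_p: "degree p \<le> m"
    by (rule degree_le) (simp add: coeff_p)
  \<comment> \<open>The bound equals \<open>2 * m - 1\<close>, so the coefficient of
    \<open>D\<close> at \<open>2 * m\<close> comes from \<open>p ^ 2\<close> alone.\<close>
  have deg_sr: "degree (s ^ 2 * r) \<le> 2 * (m - n) + (2 * n - 1)"
    using degree_mult_le[of "s ^ 2" r] degree_power_le[of s 2] s(2) r by simp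
  then have sr: "degree (s ^ 2 * r) < 2 * m"
    using n by linarith
  have deg_p2: "degree (p ^ 2) \<le> 2 * m"
    using degree_power_le[of p 2] deg_p by simp
  have "coeff (p ^ 2) (2 * m) = (coeff p m)\<^sup>2"
    using coeff_mult_degree_sum[of p p] deg_p
    by (cases "degree p = m")
      (auto simp: power2_eq_square mult_2 coeff_eq_0 intro!: coeff_eq_0
        intro: le_less_trans[OF degree_mult_le])
  then have top: "coeff D (2 * m) = - (coeff p m)\<^sup>2"
    using sr by (simp add: D_def coeff_eq_0)
  have high: "coeff D k = 0" if "2 * m < k" for k
    using that sr deg_p2 by (simp add: D_def coeff_eq_0)
  \<comment> \<open>Coefficients up to \<open>m\<close> cancel by the choice of \<open>p\<close>;
    those from \<open>m + 1\<close> to \<open>2 * m - 1\<close> vanish by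
    \<open>van\<close>.\<close>
  have dvd_diff: "fps_X ^ (2 * m) dvd fps_of_poly s * F - fps_of_poly p"
    using van by (auto simp: fps_X_power_dvd_iff coeff_p)
  then have "fps_X ^ (2 * m) dvd fps_of_poly D"
    unfolding fac by simp
  then have low: "coeff D k = 0" if "k < 2 * m" for k
    using that by (simp add: fps_X_power_dvd_iff)
  have "D = - monom ((coeff p m)\<^sup>2) (2 * m)"
    using low high top by (auto simp: poly_eq_iff) (metis linorder_neqE_nat)
  then show pell: "s ^ 2 * r = p ^ 2 - monom ((coeff p m)\<^sup>2) (2 * m)"
    by (simp add: D_def algebra_simps)
  have "odd (degree r)"
    using r n by simp
  then show lead: "coeff p m \<noteq> 0"
    using pell odd_degree_square_mult_neq_square[of r s p] s by auto
  show p0: "coeff p 0 = coeff s 0"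
    using F by (simp add: coeff_p)
  show "coeff s 0 \<noteq> 0"
  proof
    assume "coeff s 0 = 0"
    \<comment> \<open>The constant term of the second factor is twice \<open>coeff s 0\<close>. If
      it vanishes, \<open>D\<close> gains one more power of \<open>fps_X\<close> and loses its only
      nonzero coefficient.\<close>
    then have "fps_X ^ 1 dvd fps_of_poly s * F + fps_of_poly p"
      using p0 by (subst fps_X_power_dvd_iff) simp
    then have "fps_X ^ (2 * m) * fps_X ^ 1 dvd fps_of_poly D"
      unfolding fac using dvd_diff by (rule mult_dvd_mono[rotated])
    then have "coeff D (2 * m) = 0"
      unfolding power_add[symmetric] fps_X_power_dvd_iff by simp
    then show False
      using top lead by simp
  qed
qed

text \<open>The normalisation at 0 gives \<open>s F + p\<close> the constant term 2, a unit in
  characteristic 0. Cancelling it leaves \<open>s F - p\<close> divisible by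
  \<open>fps_X ^ (2 * m)\<close>, and \<open>p\<close> has no terms above degree
  \<open>m\<close>.\<close>

lemma vanishing_coeffs_of_pell:
  fixes F :: "'a :: field_char_0 fps"
  assumes F: "F ^ 2 = fps_of_poly r" "fps_nth F 0 = 1"
    and pell: "s ^ 2 * r = p ^ 2 - monom b (2 * m)"
    and 0: "coeff s 0 = 1" "coeff p 0 = 1" and p: "degree p \<le> m"
    and l: "l \<in> {m + 1..2 * m - 1}"
  shows "fps_nth (fps_of_poly s * F) l = 0"
proof -
  let ?u = "fps_of_poly s * F + fps_of_poly p"
  have "fps_nth ?u 0 = 2"
    using F 0 by simp
  then have "is_unit ?u"
    by simp
  have "fps_of_poly (s ^ 2 * r - p ^ 2) = - fps_of_poly (monom b (2 * m))"
    by (simp add: pell fps_of_poly_uminus)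
  then have "fps_X ^ (2 * m) dvd fps_of_poly (s ^ 2 * r - p ^ 2)"
    by (simp add: fps_X_power_dvd_iff)
  then have "fps_X ^ (2 * m) dvd fps_of_poly s * F - fps_of_poly p"
    unfolding fps_square_diff[OF F(1)] using \<open>is_unit ?u\<close> by (simp only: dvd_mult_unit_iff)
  moreover have "l < 2 * m"
    using l by auto
  ultimately have "fps_nth (fps_of_poly s * F - fps_of_poly p) l = 0"
    unfolding fps_X_power_dvd_iff by blast
  moreover have "coeff p l = 0"
    using l p by (intro coeff_eq_0) auto
  ultimately show ?thesis
    by simp
qed

lemma vanishing_coeffs_iff_pell:
  fixes F :: "'a :: field_char_0 fps"
  assumes F: "F ^ 2 = fps_of_poly r" "fps_nth F 0 = 1"
    and r: "degree r = 2 * n - 1" and n: "0 < n" "n \<le> m"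
  shows "(\<exists>s. s \<noteq> 0 \<and> degree s \<le> m - n \<and>
      (\<forall>l\<in>{m + 1..2 * m - 1}. fps_nth (fps_of_poly s * F) l = 0)) \<longleftrightarrow>
    (\<exists>\<alpha> s q. \<alpha> \<noteq> 0 \<and> degree s \<le> m - n \<and> degree q \<le> m - 1 \<and> poly s 0 = 1 \<and> poly q 0 = 1 \<and>
      s ^ 2 * r = (monom \<alpha> m + q) * q)" (is "?van \<longleftrightarrow> ?pell")
proof
  assume ?van
  then obtain s where s: "s \<noteq> 0" "degree s \<le> m - n"
    and van: "\<forall>l\<in>{m + 1..2 * m - 1}. fps_nth (fps_of_poly s * F) l = 0"
    by blast
  have s0: "coeff s 0 \<noteq> 0"
    by (rule pell_of_vanishing_coeffs(3)[OF F r n s van])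
  \<comment> \<open>The vanishing conditions are linear in \<open>s\<close>, so they survive scaling
    to \<open>s'(0) = 1\<close>.\<close>
  define s' where "s' = smult (1 / coeff s 0) s"
  define p where "p = truncate_fps (m + 1) (fps_of_poly s' * F)"
  have "s' \<noteq> 0" "degree s' \<le> m - n"
    and "\<forall>l\<in>{m + 1..2 * m - 1}. fps_nth (fps_of_poly s' * F) l = 0"
    using s s0 van by (auto simp: s'_def fps_of_poly_smult mult.assoc)
  note pell = pell_of_vanishing_coeffs[OF F r n this, folded p_def]
  have "coeff s' 0 = 1"
    using s0 by (simp add: s'_def)
  \<comment> \<open>Removing the term of degree \<open>m\<close> lowers the degree bound to
    \<open>m - 1\<close>. With \<open>a = coeff p m\<close>, the other factor
    \<open>p + a t^m\<close> of \<open>p^2 - a^2 t^(2m)\<close> is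
    \<open>q + 2 a t^m\<close>.\<close>
  define q where "q = p - monom (coeff p m) m"
  have "degree q \<le> m - 1"
  proof (rule degree_le, intro allI impI)
    fix k assume "m - 1 < k"
    then show "coeff q k = 0"
      using pell(4) n by (cases "k = m") (auto simp: q_def coeff_eq_0)
  qed
  moreover have "poly q 0 = 1"
    using n pell(5) \<open>coeff s' 0 = 1\<close> by (simp add: q_def poly_0_coeff_0)
  moreover have "s' ^ 2 * r = (monom (2 * coeff p m) m + q) * q"
  proof -
    have "monom (2 * coeff p m) m = 2 * monom (coeff p m) m"
      by (simp add: poly_eq_iff numeral_poly)
    moreover have "monom ((coeff p m)\<^sup>2) (2 * m) = monom (coeff p m) m ^ 2"
      by (simp add: monom_power mult.commute)
    ultimately show ?thesis
      unfolding pell(1) q_def by (simp add: power2_eq_square algebra_simps)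
  qed
  ultimately show ?pell
    using pell(2) \<open>coeff s' 0 = 1\<close> \<open>degree s' \<le> m - n\<close>
    by (intro exI[of _ "2 * coeff p m"] exI[of _ s'] exI[of _ q]) (simp add: poly_0_coeff_0)
next
  assume ?pell
  then obtain \<alpha> s q where s: "degree s \<le> m - n" and q: "degree q \<le> m - 1"
    and 0: "poly s 0 = 1" "poly q 0 = 1" and eq: "s ^ 2 * r = (monom \<alpha> m + q) * q"
    by blast
  \<comment> \<open>Completing the square: \<open>p\<close> is the mean of the two factors
    \<open>q\<close> and \<open>\<alpha> t^m + q\<close>.\<close>
  define p where "p = q + monom (\<alpha> / 2) m"
  have half: "monom \<alpha> m = 2 * monom (\<alpha> / 2) m"
    by (simp add: poly_eq_iff numeral_poly)
  have "monom ((\<alpha> / 2)\<^sup>2) (2 * m) = monom (\<alpha> / 2) m ^ 2"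
    by (simp add: monom_power mult.commute)
  then have "s ^ 2 * r = p ^ 2 - monom ((\<alpha> / 2)\<^sup>2) (2 * m)"
    unfolding eq p_def half by (simp add: power2_eq_square algebra_simps)
  moreover have "degree p \<le> m"
    unfolding p_def using q by (intro degree_add_le degree_monom_le) auto
  moreover have "coeff p 0 = 1" "coeff s 0 = 1"
    using 0 n by (simp_all add: p_def poly_0_coeff_0)
  ultimately have "\<forall>l\<in>{m + 1..2 * m - 1}. fps_nth (fps_of_poly s * F) l = 0"
    using vanishing_coeffs_of_pell[OF F] by blast
  moreover have "s \<noteq> 0"
    using 0 by auto
  ultimately show ?van
    using s by blast
qed

section \<open>The Cayley condition\<close>

text \<open>The entries depend only on \<open>i - j\<close>, so applying the matrix to a coefficient
  vector computes coefficients of a Cauchy product.\<close>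

lemma cayley_matrix_mult_vec:
  assumes F: "cayley_sqrt n c has_fps_expansion F" and nm: "n \<le> m" and i: "i < m - 1"
    and s: "degree s \<le> m - n"
  shows "(cayley_matrix m n c *\<^sub>v vec (m - n + 1) (coeff s)) $ i =
    fps_nth (fps_of_poly s * F) (m + 1 + i)"
proof -
  have "(cayley_matrix m n c *\<^sub>v vec (m - n + 1) (coeff s)) $ i =
      (\<Sum>j\<in>{0..<m - n + 1}. fps_nth F (m + 1 + i - j) * coeff s j)"
    using i by (simp add: cayley_matrix_def mult_mat_vec_def scalar_prod_def taylor_coeff_def
        has_fps_expansion_deriv_at_0[OF F])
  \<comment> \<open>The added terms vanish, as \<open>s\<close> has no coefficients beyond
    \<open>m - n\<close>.\<close>
  also have "\<dots> = (\<Sum>j\<in>{0..m + 1 + i}. coeff s j * fps_nth F (m + 1 + i - j))"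
    using s by (intro sum.mono_neutral_cong_left) (auto simp: coeff_eq_0)
  finally show ?thesis
    by (simp add: fps_mult_nth)
qed

text \<open>A rank below the number of columns means a nonzero kernel vector, and vectors of length
  \<open>m - n + 1\<close> are the coefficient vectors of polynomials of degree at most
  \<open>m - n\<close>.\<close>

lemma cayley_condition_iff_vanishing_coeffs:
  assumes F: "cayley_sqrt n c has_fps_expansion F" and nm: "n \<le> m"
  shows "cayley_condition m n c \<longleftrightarrow> (\<exists>s. s \<noteq> 0 \<and> degree s \<le> m - n \<and>
    (\<forall>l\<in>{m + 1..2 * m - 1}. fps_nth (fps_of_poly s * F) l = 0))"
proof -
  let ?A = "cayley_matrix m n c" and ?N = "m - n + 1"
  have A: "?A \<in> carrier_mat (m - 1) ?N"
    by (simp add: cayley_matrix_def)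
  have ker: "?A *\<^sub>v vec ?N (coeff s) = 0\<^sub>v (m - 1) \<longleftrightarrow>
      (\<forall>l\<in>{m + 1..2 * m - 1}. fps_nth (fps_of_poly s * F) l = 0)"
    if "degree s \<le> m - n" for s
  proof -
    have "?A *\<^sub>v vec ?N (coeff s) = 0\<^sub>v (m - 1) \<longleftrightarrow>
        (\<forall>i<m - 1. fps_nth (fps_of_poly s * F) (m + 1 + i) = 0)"
      using A cayley_matrix_mult_vec[OF F nm _ that] by (auto simp: vec_eq_iff)
    also have "\<dots> \<longleftrightarrow> (\<forall>l\<in>{m + 1..2 * m - 1}. fps_nth (fps_of_poly s * F) l = 0)"
    \<comment> \<open>Row \<open>i\<close> corresponds to \<open>l = m + 1 + i\<close>; the
      \<open>m - 1\<close> rows cover exactly \<open>m + 1\<close> to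
      \<open>2 * m - 1\<close>.\<close>
    proof safe
      fix l assume *: "\<forall>i<m - 1. fps_nth (fps_of_poly s * F) (m + 1 + i) = 0" "l \<in> {m + 1..2 * m - 1}"
      then show "fps_nth (fps_of_poly s * F) l = 0"
        using *(1)[rule_format, of "l - (m + 1)"] by auto
    qed auto
    finally show ?thesis .
  qed
  have "cayley_condition m n c \<longleftrightarrow> (\<exists>v \<in> carrier_vec ?N. v \<noteq> 0\<^sub>v ?N \<and> ?A *\<^sub>v v = 0\<^sub>v (m - 1))"
    using nm by (simp only: cayley_condition_def vec_space.rank_less_iff_kernel[OF A] simp_thms)
  also have "\<dots> \<longleftrightarrow> (\<exists>s. s \<noteq> 0 \<and> degree s \<le> m - n \<and> ?A *\<^sub>v vec ?N (coeff s) = 0\<^sub>v (m - 1))"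
  proof safe
    fix v :: "real vec" assume v: "v \<in> carrier_vec ?N" "v \<noteq> 0\<^sub>v ?N" "?A *\<^sub>v v = 0\<^sub>v (m - 1)"
    define s where "s = (\<Sum>j<?N. monom (v $ j) j)"
    have coeff_s: "coeff s k = (if k < ?N then v $ k else 0)" for k
      by (simp add: s_def coeff_sum sum.delta')
    then have "vec ?N (coeff s) = v"
      using v by (intro eq_vecI) auto
    moreover have "degree s \<le> m - n"
      by (rule degree_le) (simp add: coeff_s)
    moreover have "s \<noteq> 0"
      using v \<open>vec ?N (coeff s) = v\<close> by auto
    ultimately show "\<exists>s. s \<noteq> 0 \<and> degree s \<le> m - n \<and> ?A *\<^sub>v vec ?N (coeff s) = 0\<^sub>v (m - 1)"
      using v by auto
  next
    fix s :: "real poly" assume s: "s \<noteq> 0" "degree s \<le> m - n" "?A *\<^sub>v vec ?N (coeff s) = 0\<^sub>v (m - 1)"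
    \<comment> \<open>The leading coefficient of \<open>s\<close> witnesses that the vector is
      nonzero.\<close>
    have "vec ?N (coeff s) $ degree s \<noteq> 0\<^sub>v ?N $ degree s"
      using s by simp
    then show "\<exists>v \<in> carrier_vec ?N. v \<noteq> 0\<^sub>v ?N \<and> ?A *\<^sub>v v = 0\<^sub>v (m - 1)"
      using s(3) by (intro bexI[of _ "vec ?N (coeff s)"]) auto
  qed
  finally show ?thesis
    using ker by blast
qed

theorem theorem7:
  fixes m n :: nat and c :: "nat \<Rightarrow> real"
  assumes "2 \<le> n" and "n \<le> m"
    and "0 < c 1" and "strict_mono_on {1..2 * n - 1} c"
  shows "(cayley_condition m n c \<longleftrightarrow>
           (\<exists>s :: real poly. s \<noteq> 0 \<and> degree s \<le> m - n \<and>
              (\<forall>l\<in>{m + 1..2 * m - 1}.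
                 (deriv ^^ l) (\<lambda>t. poly s t * cayley_sqrt n c t) 0 = 0)))
       \<and> (cayley_condition m n c \<longleftrightarrow>
           (\<exists>(\<alpha> :: real) (s :: real poly) (q :: real poly).
              \<alpha> \<noteq> 0 \<and> degree s \<le> m - n \<and> degree q \<le> m - 1 \<and>
              poly s 0 = 1 \<and> poly q 0 = 1 \<and>
              s ^ 2 * cayley_poly n c = (Polynomial.monom \<alpha> m + q) * q))"
proof -
  obtain F :: "real fps" where F: "cayley_sqrt n c has_fps_expansion F"
    "F ^ 2 = fps_of_poly (cayley_poly n c)" "fps_nth F 0 = 1"
    by (rule cayley_sqrt_expansion)
  have "c i \<noteq> 0" if "i \<in> {1..2 * n - 1}" for i
    using assms that strict_mono_onD[OF assms(4), of 1 i] by (cases "i = 1") auto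
  then have r: "degree (cayley_poly n c) = 2 * n - 1"
    by (rule degree_cayley_poly)
  \<comment> \<open>The factor \<open>fact l\<close> is nonzero, so vanishing derivatives and
    vanishing coefficients are the same condition.\<close>
  have deriv: "(deriv ^^ l) (\<lambda>t. poly s t * cayley_sqrt n c t) 0 =
      fact l * fps_nth (fps_of_poly s * F) l" for l s
    by (intro has_fps_expansion_deriv_at_0 has_fps_expansion_mult has_fps_expansion_poly F)
  have "0 < n"
    using assms by simp
  note pell = vanishing_coeffs_iff_pell[OF F(2,3) r \<open>0 < n\<close> assms(2)]
  show ?thesis
    using cayley_condition_iff_vanishing_coeffs[OF F(1) assms(2)] pell by (simp add: deriv)
qed

end
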